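(* Let $X\subseteq\mathbb{C}$ be compact and perfect and let $\mathcal{F}$ be a useful set of paths in $X$. Then $D^1(X)\subseteq\mathcal{D}^1_{\mathcal{F}}(X)$; indeed, for each $f\in D^1(X)$ the complex derivative $f'$ is also an $\mathcal{F}$-derivative of $f$. If $\overline{\mathcal{F}(X)}=X$, then the inclusion $D^1(X)\subseteq\mathcal{D}^1_{\mathcal{F}}(X)$ is isometric.
   Context: Perfect means non-empty without isolated points. A function $f:X\to\mathbb{C}$ is complex-differentiable at $a\in X$ if $f'(a)=\lim_{z\to a,\,z\in X\setminus\{a\}}\frac{f(z)-f(a)}{z-a}$ exists. $D^1(X)$ is the space of continuously complex-differentiable functions on $X$, with norm $\|f\|=\|f\|_\infty+\|f'\|_\infty$. A path in $X$ is a continuous map $\gamma:[a,b]\to X$ with $a<b$ real; its endpoints are $\gamma^-=\gamma(a)$ and $\gamma^+=\gamma(b)$. A Jordan arc is an injective path. A set $\mathcal{F}$ of paths in $X$ is useful if every path in $\mathcal{F}$ is a rectifiable Jordan arc and, whenever $\gamma\in\mathcal{F}$ is defined on $[a,b]$ and $[c,d]\subseteq[a,b]$ with $c<d$, the restriction of $\gamma$ to $[c,d]$ is in $\mathcal{F}$. Write $\mathcal{F}(X)=\bigcup_{\gamma\in\mathcal{F}}\mathrm{Image}(\gamma)$. For $f\in C(X)$ (continuous complex-valued functions on $X$), a function $g\in C(X)$ is an $\mathcal{F}$-derivative of $f$ if $\int_\gamma g(z)\,dz=f(\gamma^+)-f(\gamma^-)$ for every $\gamma\in\mathcal{F}$.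 $\mathcal{D}^1_{\mathcal{F}}(X)$ is the set of $f\in C(X)$ which have an $\mathcal{F}$-derivative in $C(X)$; for non-empty $\mathcal{F}$ it carries the norm $\|f\|=\|f\|_\infty+\|g\|_{\overline{\mathcal{F}(X)}}$, where $g$ is any $\mathcal{F}$-derivative of $f$ (well defined, since any two $\mathcal{F}$-derivatives of $f$ agree on $\overline{\mathcal{F}(X)}$). $\|\cdot\|_\infty$ is the supremum norm on $X$ and $\|\cdot\|_E$ the supremum norm on a closed set $E\subseteq X$. *)

theory Defs
  imports "HOL-Analysis.Analysis"
begin

text \<open>A function on a set \<open>X\<close> is represented by a total function, of which only the values on
  \<open>X\<close> matter; membership in \<open>C(X)\<close> is \<open>continuous_on X f\<close>.\<close>

definition perfect :: "complex set \<Rightarrow> bool" where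
  "perfect X \<longleftrightarrow> X \<noteq> {} \<and> (\<forall>x\<in>X. \<not> x isolated_in X)"

definition sup_norm :: "complex set \<Rightarrow> (complex \<Rightarrow> complex) \<Rightarrow> real" where
  "sup_norm E f = (SUP z\<in>E. norm (f z))"

definition cderiv :: "complex set \<Rightarrow> (complex \<Rightarrow> complex) \<Rightarrow> complex \<Rightarrow> complex" where
  "cderiv X f a = (THE D. (f has_field_derivative D) (at a within X))"

definition D1 :: "complex set \<Rightarrow> (complex \<Rightarrow> complex) set" where
  "D1 X = {f. (\<forall>a\<in>X. f field_differentiable (at a within X)) \<and> continuous_on X (cderiv X f)}"

definition D1_norm :: "complex set \<Rightarrow> (complex \<Rightarrow> complex) \<Rightarrow> real" where
  "D1_norm X f = sup_norm X f + sup_norm X (cderiv X f)"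

text \<open>The triple \<open>(a, b, \<gamma>)\<close> stands for a path with parameter interval \<open>[a, b]\<close>. The map \<open>\<gamma>\<close> is
  required to be extensional, so that distinct triples are distinct paths and \<open>restrict\<close> is
  restriction of paths.\<close>

type_synonym cpath = "real \<times> real \<times> (real \<Rightarrow> complex)"

definition path_in :: "complex set \<Rightarrow> cpath \<Rightarrow> bool" where
  "path_in X = (\<lambda>(a, b, \<gamma>). a < b \<and> \<gamma> \<in> {a..b} \<rightarrow>\<^sub>E X \<and> continuous_on {a..b} \<gamma>)"

definition jordan_arc_in :: "complex set \<Rightarrow> cpath \<Rightarrow> bool" where
  "jordan_arc_in X = (\<lambda>(a, b, \<gamma>). path_in X (a, b, \<gamma>) \<and> inj_on \<gamma> {a..b})"

text \<open>The members of a division of \<open>{a..b}\<close> are closed intervals \<open>k = {Inf k..Sup k}\<close>.\<close>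

definition rectifiable :: "cpath \<Rightarrow> bool" where
  "rectifiable = (\<lambda>(a, b, \<gamma>).
     bdd_above ((\<lambda>d. \<Sum>k\<in>d. norm (\<gamma> (Sup k) - \<gamma> (Inf k))) ` {d. d division_of {a..b}}))"

definition useful :: "complex set \<Rightarrow> cpath set \<Rightarrow> bool" where
  "useful X F \<longleftrightarrow>
     (\<forall>p\<in>F. jordan_arc_in X p \<and> rectifiable p) \<and>
     (\<forall>a b \<gamma> c d. (a, b, \<gamma>) \<in> F \<and> c < d \<and> {c..d} \<subseteq> {a..b} \<longrightarrow> (c, d, restrict \<gamma> {c..d}) \<in> F)"

definition images :: "cpath set \<Rightarrow> complex set" where
  "images F = (\<Union>(a, b, \<gamma>)\<in>F. \<gamma> ` {a..b})"

text \<open>The integral of \<open>g\<close> along a rectifiable path is the Riemann-Stieltjes integral of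
  \<open>g \<circ> \<gamma>\<close> with respect to \<open>\<gamma>\<close>, i.e. the limit of Riemann-Stieltjes sums as the mesh tends
  to 0. The library's contour integral is not suitable: it integrates against the
  pointwise derivative of \<open>\<gamma>\<close>, which gives the wrong value for rectifiable paths that
  are not absolutely continuous.\<close>

definition has_path_integral ::
    "(complex \<Rightarrow> complex) \<Rightarrow> complex \<Rightarrow> cpath \<Rightarrow> bool"  (infixr \<open>has'_path'_integral\<close> 50) where
  "(g has_path_integral I) = (\<lambda>(a, b, \<gamma>).
     \<forall>e>0. \<exists>\<delta>>0. \<forall>p. p tagged_division_of {a..b} \<and> (\<lambda>t. ball t \<delta>) fine p \<longrightarrow>
       norm ((\<Sum>(t, k)\<in>p. g (\<gamma> t) * (\<gamma> (Sup k) - \<gamma> (Inf k))) - I) < e)"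

definition F_derivative ::
    "complex set \<Rightarrow> cpath set \<Rightarrow> (complex \<Rightarrow> complex) \<Rightarrow> (complex \<Rightarrow> complex) \<Rightarrow> bool" where
  "F_derivative X F f g \<longleftrightarrow> continuous_on X f \<and> continuous_on X g \<and>
     (\<forall>(a, b, \<gamma>)\<in>F. (g has_path_integral (f (\<gamma> b) - f (\<gamma> a))) (a, b, \<gamma>))"

definition DF1 :: "complex set \<Rightarrow> cpath set \<Rightarrow> (complex \<Rightarrow> complex) set" where
  "DF1 X F = {f. continuous_on X f \<and> (\<exists>g. F_derivative X F f g)}"

text \<open>Any two \<open>F\<close>-derivatives of \<open>f\<close> agree on \<open>closure (images F)\<close>, so the choice of \<open>g\<close> is
  immaterial; the norm is only meaningful for non-empty \<open>F\<close>.\<close>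

definition DF1_norm :: "complex set \<Rightarrow> cpath set \<Rightarrow> (complex \<Rightarrow> complex) \<Rightarrow> real" where
  "DF1_norm X F f =
     sup_norm X f + sup_norm (closure (images F)) (SOME g. F_derivative X F f g)"

end

theory Submission
  imports Defs
begin

text \<open>A rectifiable path has a monotone variation function \<open>V\<close> bounding its increments. Along the
  path, differentiability of \<open>f\<close> bounds the increments of \<open>f \<circ> \<gamma> - c \<gamma>\<close> near each parameter by
  those of \<open>V\<close>, up to a factor close to \<open>\<bar>f' - c\<bar>\<close>; Cousin's lemma turns this pointwise estimate
  into a global one, although the difference quotients of \<open>f\<close> need not converge uniformly
  on \<open>X\<close>. This shows that the Riemann-Stieltjes sums of \<open>f'\<close> converge to \<open>f(\<gamma>\<^sup>+) - f(\<gamma>\<^sup>-)\<close>. The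
  isometry follows from the uniqueness of \<open>F\<close>-derivatives on \<open>closure (images F)\<close>: if \<open>g\<close> has
  vanishing integrals but is nonzero at some \<open>\<gamma> t\<close>, then near \<open>t\<close> every monotone function that
  bounds the increments of \<open>\<gamma>\<close> can be halved, so \<open>\<gamma>\<close> is constant there.\<close>

section \<open>Estimates over tagged divisions\<close>

text \<open>Triangle inequality, after which the increments of \<open>V\<close> telescope. The bound
  is asked only for members of \<open>p\<close>, so that fineness of \<open>p\<close> can be used to
  prove it.\<close>

lemma norm_tagged_sum_le:
  fixes \<phi> :: "real \<Rightarrow> real \<Rightarrow> real \<Rightarrow> 'a::real_normed_vector"
  assumes p: "p tagged_division_of {a..b}" and "a \<le> b"
    and le: "\<And>t u v. \<lbrakk>(t, {u..v}) \<in> p; a \<le> u; u \<le> t; t \<le> v; v \<le> b\<rbrakk> \<Longrightarrow> norm (\<phi> t u v) \<le> V v - V u"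
  shows "norm (\<Sum>(t, k)\<in>p. \<phi> t (Inf k) (Sup k)) \<le> V b - V a"
proof -
  have "norm (\<Sum>(t, k)\<in>p. \<phi> t (Inf k) (Sup k)) \<le> (\<Sum>(t, k)\<in>p. V (Sup k) - V (Inf k))"
  proof (rule sum_norm_le)
    fix x assume x: "x \<in> p"
    obtain t k where tk: "x = (t, k)" by (cases x)
    obtain u v where k: "k = {u..v}"
      using tagged_division_ofD(4)[OF p] x tk by (metis box_real(2))
    have "t \<in> {u..v}" "{u..v} \<subseteq> {a..b}"
      using tagged_division_ofD(2,3)[OF p, of t k] x tk k by auto
    then show "norm (case x of (t, k) \<Rightarrow> \<phi> t (Inf k) (Sup k))
        \<le> (case x of (t, k) \<Rightarrow> V (Sup k) - V (Inf k))"
      using le[of t u v] x tk k by auto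
  qed
  also have "\<dots> = V b - V a"
    using additive_tagged_division_1[OF \<open>a \<le> b\<close> p] .
  finally show ?thesis .
qed

text \<open>Local bounds become a global one through a division that is fine for the pointwise
  radii. The tag \<open>t\<close> of \<open>{u..v}\<close> lies between \<open>u\<close> and
  \<open>v\<close>, so by monotonicity the bounds on its two sides add up to
  \<open>V v - V u\<close>.\<close>

lemma norm_diff_le_of_local:
  fixes h :: "real \<Rightarrow> 'a::real_normed_vector" and V :: "real \<Rightarrow> real"
  assumes "a \<le> b"
    and local: "\<And>s. s \<in> {a..b} \<Longrightarrow>
      \<exists>\<delta>>0. \<forall>r\<in>{a..b}. dist s r < \<delta> \<longrightarrow> norm (h r - h s) \<le> \<bar>V r - V s\<bar>"
    and mono: "\<And>r s. \<lbrakk>a \<le> r; r \<le> s; s \<le> b\<rbrakk> \<Longrightarrow> V r \<le> V s"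
  shows "norm (h b - h a) \<le> V b - V a"
proof -
  obtain \<delta> where \<delta>: "\<And>s. s \<in> {a..b} \<Longrightarrow> \<delta> s > 0 \<and>
      (\<forall>r\<in>{a..b}. dist s r < \<delta> s \<longrightarrow> norm (h r - h s) \<le> \<bar>V r - V s\<bar>)"
    using local by metis
  \<comment> \<open>A gauge is defined on the whole line; the radius 1 outside \<open>{a..b}\<close>
    is a dummy, as all tags lie in \<open>{a..b}\<close>.\<close>
  have "gauge (\<lambda>s. ball s (if s \<in> {a..b} then \<delta> s else 1))"
    using \<delta> by (auto simp: gauge_def)
  then obtain p where p: "p tagged_division_of {a..b}"
      and fine: "(\<lambda>s. ball s (if s \<in> {a..b} then \<delta> s else 1)) fine p"
    by (rule fine_division_exists_real)
  have "norm (\<Sum>(t, k)\<in>p. h (Sup k) - h (Inf k)) \<le> V b - V a"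
  proof (rule norm_tagged_sum_le[OF p \<open>a \<le> b\<close>, where \<phi> = "\<lambda>t u v. h v - h u"])
    fix t u v assume tuv: "(t, {u..v}) \<in> p" "a \<le> u" "u \<le> t" "t \<le> v" "v \<le> b"
    then have t: "t \<in> {a..b}" by auto
    have "{u..v} \<subseteq> ball t (\<delta> t)"
      using fineD[OF fine tuv(1)] t by (auto split: if_splits)
    then have "u \<in> ball t (\<delta> t)" "v \<in> ball t (\<delta> t)"
      using tuv by (meson atLeastAtMost_iff order.refl order.trans subsetD)+
    then have "norm (h u - h t) \<le> \<bar>V u - V t\<bar>" "norm (h v - h t) \<le> \<bar>V v - V t\<bar>"
      using \<delta>[OF t] tuv by auto
    moreover have "V u \<le> V t" "V t \<le> V v"
      using mono tuv by auto
    moreover have "norm (h v - h u) \<le> norm (h v - h t) + norm (h u - h t)"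
      by (metis norm_triangle_ineq4 diff_diff_eq2 diff_add_cancel)
    ultimately show "norm (h v - h u) \<le> V v - V u" by linarith
  qed
  then show ?thesis
    using additive_tagged_division_1[OF \<open>a \<le> b\<close> p, of h] by simp
qed

section \<open>Variation of a rectifiable path\<close>

text \<open>Lets a division grow to the right. That the new interval is not already a member ensures
  that a sum over the division gains exactly one term.\<close>

lemma division_of_insert_right:
  fixes a b c :: real
  assumes d: "d division_of {a..b}" and "a \<le> b" "b < c"
  shows "insert {b..c} d division_of {a..c}" and "{b..c} \<notin> d"
proof -
  have sub: "k \<subseteq> {a..b}" if "k \<in> d" for k
    using division_ofD(2)[OF d that] .
  show "{b..c} \<notin> d"
    using sub[of "{b..c}"] \<open>b < c\<close> by auto
  have "{{b..c}} division_of {b..c}"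
    using division_of_self[of b c] \<open>b < c\<close> by simp
  moreover have "interior {a..b} \<inter> interior {b..c} = {}"
    by auto
  ultimately have "d \<union> {{b..c}} division_of {a..b} \<union> {b..c}"
    using division_disjoint_union[OF d] by blast
  moreover have "{a..b} \<union> {b..c} = {a..c}"
    using assms by auto
  ultimately show "insert {b..c} d division_of {a..c}" by simp
qed

text \<open>\<open>V s\<close> is the total variation of \<open>\<gamma>\<close> on
  \<open>{a..s}\<close>. Appending \<open>{r..s}\<close> to any division of \<open>{a..r}\<close>
  adds \<open>norm (\<gamma> s - \<gamma> r)\<close> to its sum, so the supremum grows by at least
  that much.\<close>

lemma rectifiable_variation:
  assumes rect: "rectifiable (a, b, \<gamma>)"
  obtains V :: "real \<Rightarrow> real"
  where "\<And>r s. \<lbrakk>a \<le> r; r \<le> s; s \<le> b\<rbrakk> \<Longrightarrow> norm (\<gamma> s - \<gamma> r) \<le> V s - V r"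
proof -
  define \<sigma> where "\<sigma> d = (\<Sum>k\<in>d. norm (\<gamma> (Sup k) - \<gamma> (Inf k)))" for d
  define V where "V s = (SUP d\<in>{d. d division_of {a..s}}. \<sigma> d)" for s
  have ins: "\<sigma> (insert {r..s} d) = norm (\<gamma> s - \<gamma> r) + \<sigma> d"
    if "d division_of {a..r}" "a \<le> r" "r < s" for r s d
    using division_of_insert_right(2)[OF that] division_ofD(1)[OF that(1)] that(3)
    by (simp add: \<sigma>_def)
  obtain B where B: "\<And>d. d division_of {a..b} \<Longrightarrow> \<sigma> d \<le> B"
    using rect by (auto simp: rectifiable_def bdd_above_def \<sigma>_def)
  have bdd: "bdd_above (\<sigma> ` {d. d division_of {a..s}})" if "a \<le> s" "s \<le> b" for s
  proof (rule bdd_aboveI2)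
    fix d assume "d \<in> {d. d division_of {a..s}}"
    then have d: "d division_of {a..s}" by simp
    show "\<sigma> d \<le> B"
    \<comment> \<open>For \<open>s < b\<close>, appending \<open>{s..b}\<close> gives a division of
      \<open>{a..b}\<close> with no smaller sum; for \<open>s = b\<close> the bound \<open>B\<close>
      applies directly.\<close>
    proof (cases "s = b")
      case False
      then have "s < b" using that by simp
      show ?thesis
        using B[OF division_of_insert_right(1)[OF d \<open>a \<le> s\<close> \<open>s < b\<close>]] ins[OF d \<open>a \<le> s\<close> \<open>s < b\<close>]
        by (smt (verit) norm_ge_zero)
    qed (use B d in auto)
  qed
  have "norm (\<gamma> s - \<gamma> r) \<le> V s - V r" if "a \<le> r" "r \<le> s" "s \<le> b" for r s
  proof (cases "r = s")
    case False
    then have "r < s" using that by simp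
    have ne: "{d. d division_of {a..r}} \<noteq> {}"
      using division_of_self[of a r] \<open>a \<le> r\<close> by auto
    have "V r \<le> V s - norm (\<gamma> s - \<gamma> r)"
      unfolding V_def[of r]
    proof (rule cSUP_least[OF ne])
      fix d assume "d \<in> {d. d division_of {a..r}}"
      then have d: "d division_of {a..r}" by simp
      have "\<sigma> (insert {r..s} d) \<le> V s"
        unfolding V_def using division_of_insert_right(1)[OF d \<open>a \<le> r\<close> \<open>r < s\<close>] that
        by (intro cSUP_upper bdd) auto
      then show "\<sigma> d \<le> V s - norm (\<gamma> s - \<gamma> r)"
        using ins[OF d \<open>a \<le> r\<close> \<open>r < s\<close>] by simp
    qed
    then show ?thesis by simp
  qed auto
  then show thesis by (rule that)
qed

section \<open>The derivative integrates to the increment of the function\<close>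

text \<open>The factor 2 collects two errors of size \<open>e\<close>: the remainder in the
  differentiability of \<open>f\<close> at \<open>\<gamma> s\<close>, and the distance of
  \<open>g (\<gamma> s)\<close> from \<open>c\<close>. Both multiply an increment of
  \<open>\<gamma>\<close>, which \<open>V\<close> controls.\<close>

lemma increment_approx:
  fixes \<gamma> :: "real \<Rightarrow> complex"
  assumes "a \<le> b" and cont: "continuous_on {a..b} \<gamma>" and "\<gamma> ` {a..b} \<subseteq> X" and "e > 0"
    and deriv: "\<And>z. z \<in> X \<Longrightarrow> (f has_field_derivative g z) (at z within X)"
    and near: "\<And>s. s \<in> {a..b} \<Longrightarrow> norm (g (\<gamma> s) - c) \<le> e"
    and V: "\<And>r s. \<lbrakk>a \<le> r; r \<le> s; s \<le> b\<rbrakk> \<Longrightarrow> norm (\<gamma> s - \<gamma> r) \<le> V s - V r"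
  shows "norm (f (\<gamma> b) - f (\<gamma> a) - c * (\<gamma> b - \<gamma> a)) \<le> 2 * e * (V b - V a)"
proof -
  have mono: "V r \<le> V s" if "a \<le> r" "r \<le> s" "s \<le> b" for r s
    using V[OF that] norm_ge_zero[of "\<gamma> s - \<gamma> r"] by linarith
  define h where "h s = f (\<gamma> s) - c * \<gamma> s" for s
  have "norm (h b - h a) \<le> 2 * e * V b - 2 * e * V a"
  proof (rule norm_diff_le_of_local[OF \<open>a \<le> b\<close>])
    show "2 * e * V r \<le> 2 * e * V s" if "a \<le> r" "r \<le> s" "s \<le> b" for r s
      using mono[OF that] \<open>e > 0\<close> by simp
  next
    fix s assume s: "s \<in> {a..b}"
    then have "\<gamma> s \<in> X" using assms by auto
    \<comment> \<open>\<open>\<eta>\<close>, and hence the later \<open>\<delta>\<close>, depends on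
      \<open>s\<close>; this is why the local bounds are joined by a gauge and not by a uniform
      mesh.\<close>
    then obtain \<eta> where "\<eta> > 0" and \<eta>: "\<And>z. \<lbrakk>z \<in> X; norm (z - \<gamma> s) < \<eta>\<rbrakk> \<Longrightarrow>
        norm (f z - f (\<gamma> s) - g (\<gamma> s) * (z - \<gamma> s)) \<le> e * norm (z - \<gamma> s)"
      using deriv[of "\<gamma> s"] \<open>e > 0\<close>
      unfolding has_field_derivative_def has_derivative_within_alt by blast
    obtain \<delta> where "\<delta> > 0" and \<delta>: "\<And>r. \<lbrakk>r \<in> {a..b}; dist r s < \<delta>\<rbrakk> \<Longrightarrow> dist (\<gamma> r) (\<gamma> s) < \<eta>"
      using cont s \<open>\<eta> > 0\<close> unfolding continuous_on_iff by metis
    have "norm (h r - h s) \<le> \<bar>2 * e * V r - 2 * e * V s\<bar>" if r: "r \<in> {a..b}" "dist s r < \<delta>" for r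
    proof -
      have "h r - h s = (f (\<gamma> r) - f (\<gamma> s) - g (\<gamma> s) * (\<gamma> r - \<gamma> s)) + (g (\<gamma> s) - c) * (\<gamma> r - \<gamma> s)"
        by (simp add: h_def algebra_simps)
      then have "norm (h r - h s) \<le> norm (f (\<gamma> r) - f (\<gamma> s) - g (\<gamma> s) * (\<gamma> r - \<gamma> s))
          + norm (g (\<gamma> s) - c) * norm (\<gamma> r - \<gamma> s)"
        by (metis norm_triangle_ineq norm_mult)
      also have "\<dots> \<le> e * norm (\<gamma> r - \<gamma> s) + e * norm (\<gamma> r - \<gamma> s)"
      proof (intro add_mono mult_right_mono near[OF s] \<eta>)
        show "\<gamma> r \<in> X" using r assms(3) by blast
        show "norm (\<gamma> r - \<gamma> s) < \<eta>"
          using \<delta>[of r] r by (simp add: dist_commute dist_norm)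
      qed simp
      also have "\<dots> = 2 * e * norm (\<gamma> r - \<gamma> s)" by simp
      also have "\<dots> \<le> 2 * e * \<bar>V r - V s\<bar>"
      proof (rule mult_left_mono)
        show "norm (\<gamma> r - \<gamma> s) \<le> \<bar>V r - V s\<bar>"
          using V[of r s] V[of s r] r s by (cases "r \<le> s") (auto simp: norm_minus_commute)
      qed (use \<open>e > 0\<close> in simp)
      also have "\<dots> = \<bar>2 * e * V r - 2 * e * V s\<bar>"
        using \<open>e > 0\<close> by (simp add: abs_mult flip: right_diff_distrib)
      finally show ?thesis .
    qed
    then show "\<exists>\<delta>>0. \<forall>r\<in>{a..b}. dist s r < \<delta> \<longrightarrow> norm (h r - h s) \<le> \<bar>2 * e * V r - 2 * e * V s\<bar>"
      using \<open>\<delta> > 0\<close> by blast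
  qed
  moreover have "h b - h a = f (\<gamma> b) - f (\<gamma> a) - c * (\<gamma> b - \<gamma> a)"
    by (simp add: h_def algebra_simps)
  ultimately show ?thesis by (simp add: right_diff_distrib)
qed

text \<open>The increments of \<open>f \<circ> \<gamma>\<close> over a tagged division telescope to
  the claimed value, so it suffices to compare each of them with its summand
  \<open>g (\<gamma> t) * (\<gamma> v - \<gamma> u)\<close>.\<close>

lemma has_path_integral_deriv:
  assumes path: "path_in X (a, b, \<gamma>)" and "rectifiable (a, b, \<gamma>)"
    and deriv: "\<And>z. z \<in> X \<Longrightarrow> (f has_field_derivative g z) (at z within X)"
    and g: "continuous_on X g"
  shows "(g has_path_integral (f (\<gamma> b) - f (\<gamma> a))) (a, b, \<gamma>)"
proof -
  have "a < b" and cont: "continuous_on {a..b} \<gamma>" and im: "\<gamma> ` {a..b} \<subseteq> X"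
    using path by (auto simp: path_in_def)
  obtain V where V: "\<And>r s. \<lbrakk>a \<le> r; r \<le> s; s \<le> b\<rbrakk> \<Longrightarrow> norm (\<gamma> s - \<gamma> r) \<le> V s - V r"
    using rectifiable_variation[OF assms(2)] by blast
  have "V b - V a \<ge> 0"
    using V[of a b] \<open>a < b\<close> by (smt (verit) norm_ge_zero)
  have "continuous_on {a..b} (g \<circ> \<gamma>)"
    using cont g im continuous_on_compose continuous_on_subset by blast
  \<comment> \<open>The definition of the integral demands one mesh \<open>\<delta>\<close> for all
    tags. Only \<open>g \<circ> \<gamma>\<close> has to be uniform for this, not the difference
    quotients of \<open>f\<close>.\<close>
  then have unif: "uniformly_continuous_on {a..b} (g \<circ> \<gamma>)"
    by (simp add: compact_uniformly_continuous)
  show ?thesis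
    unfolding has_path_integral_def prod.case
  proof (intro allI impI)
    fix e :: real assume "e > 0"
    \<comment> \<open>The 2 cancels the factor in \<open>increment_approx\<close>; the
      \<open>+ 1\<close> keeps the denominator positive and the final inequality strict.\<close>
    define \<epsilon> where "\<epsilon> = e / (2 * (V b - V a + 1))"
    have "\<epsilon> > 0" and small: "2 * \<epsilon> * (V b - V a) < e"
      using \<open>e > 0\<close> \<open>V b - V a \<ge> 0\<close> by (auto simp: \<epsilon>_def field_simps)
    obtain \<delta> where "\<delta> > 0" and \<delta>: "\<And>s t. \<lbrakk>s \<in> {a..b}; t \<in> {a..b}; dist s t < \<delta>\<rbrakk> \<Longrightarrow>
        dist (g (\<gamma> s)) (g (\<gamma> t)) < \<epsilon>"
      using unif \<open>\<epsilon> > 0\<close> unfolding uniformly_continuous_on_def o_def by metis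
    have "norm ((\<Sum>(t, k)\<in>p. g (\<gamma> t) * (\<gamma> (Sup k) - \<gamma> (Inf k))) - (f (\<gamma> b) - f (\<gamma> a))) < e"
      if p: "p tagged_division_of {a..b}" and fine: "(\<lambda>t. ball t \<delta>) fine p" for p
    proof -
      have "norm (\<Sum>(t, k)\<in>p. f (\<gamma> (Sup k)) - f (\<gamma> (Inf k)) - g (\<gamma> t) * (\<gamma> (Sup k) - \<gamma> (Inf k)))
          \<le> 2 * \<epsilon> * V b - 2 * \<epsilon> * V a"
      proof (rule norm_tagged_sum_le[OF p, where V = "\<lambda>s. 2 * \<epsilon> * V s" and
            \<phi> = "\<lambda>t u v. f (\<gamma> v) - f (\<gamma> u) - g (\<gamma> t) * (\<gamma> v - \<gamma> u)"])
        fix t u v assume tuv: "(t, {u..v}) \<in> p" "a \<le> u" "u \<le> t" "t \<le> v" "v \<le> b"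
        have sub: "{u..v} \<subseteq> {a..b}" and ball: "{u..v} \<subseteq> ball t \<delta>"
          using tuv fineD[OF fine tuv(1)] by auto
        have "norm (f (\<gamma> v) - f (\<gamma> u) - g (\<gamma> t) * (\<gamma> v - \<gamma> u)) \<le> 2 * \<epsilon> * (V v - V u)"
        \<comment> \<open>The constant \<open>c\<close> is the value of \<open>g\<close> at the tag
          \<open>t\<close>, and the path is the piece of \<open>\<gamma>\<close> over
          \<open>{u..v}\<close>.\<close>
        proof (rule increment_approx[OF _ _ _ \<open>\<epsilon> > 0\<close> deriv])
          show "norm (g (\<gamma> s) - g (\<gamma> t)) \<le> \<epsilon>" if "s \<in> {u..v}" for s
          proof -
            have "s \<in> {a..b}" "t \<in> {a..b}" "dist s t < \<delta>"
              using that sub ball tuv by (auto simp: dist_commute subset_eq)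
            then show ?thesis
              using \<delta>[of s t] by (simp add: dist_norm)
          qed
        qed (use tuv sub im V continuous_on_subset[OF cont sub] in auto)
        then show "norm (f (\<gamma> v) - f (\<gamma> u) - g (\<gamma> t) * (\<gamma> v - \<gamma> u)) \<le> 2 * \<epsilon> * V v - 2 * \<epsilon> * V u"
          by (simp add: right_diff_distrib)
      qed (use \<open>a < b\<close> in simp)
      also have "\<dots> < e"
        using small by (simp add: right_diff_distrib)
      also have "(\<Sum>(t, k)\<in>p. f (\<gamma> (Sup k)) - f (\<gamma> (Inf k)) - g (\<gamma> t) * (\<gamma> (Sup k) - \<gamma> (Inf k)))
          = (\<Sum>(t, k)\<in>p. f (\<gamma> (Sup k)) - f (\<gamma> (Inf k)))
            - (\<Sum>(t, k)\<in>p. g (\<gamma> t) * (\<gamma> (Sup k) - \<gamma> (Inf k)))"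
        by (subst sum_subtractf[symmetric]) (simp add: case_prod_unfold)
      also have "(\<Sum>(t, k)\<in>p. f (\<gamma> (Sup k)) - f (\<gamma> (Inf k))) = f (\<gamma> b) - f (\<gamma> a)"
        using additive_tagged_division_1[OF less_imp_le[OF \<open>a < b\<close>] p, of "f \<circ> \<gamma>"] by simp
      finally show ?thesis by (subst norm_minus_commute)
    qed
    then show "\<exists>\<delta>>0. \<forall>p. p tagged_division_of {a..b} \<and> (\<lambda>t. ball t \<delta>) fine p \<longrightarrow>
        norm ((\<Sum>(t, k)\<in>p. g (\<gamma> t) * (\<gamma> (Sup k) - \<gamma> (Inf k))) - (f (\<gamma> b) - f (\<gamma> a))) < e"
      using \<open>\<delta> > 0\<close> by blast
  qed
qed

section \<open>Properties of the path integral\<close>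

lemma has_path_integralE:
  assumes "(g has_path_integral I) (a, b, \<gamma>)" and "e > 0"
  obtains \<delta> where "\<delta> > 0"
    and "\<And>p. \<lbrakk>p tagged_division_of {a..b}; (\<lambda>t. ball t \<delta>) fine p\<rbrakk> \<Longrightarrow>
      norm ((\<Sum>(t, k)\<in>p. g (\<gamma> t) * (\<gamma> (Sup k) - \<gamma> (Inf k))) - I) < e"
  using assms(1)[unfolded has_path_integral_def prod.case, rule_format, OF assms(2)] by blast

lemma has_path_integral_diff:
  assumes "(g has_path_integral I) (a, b, \<gamma>)" and "(h has_path_integral J) (a, b, \<gamma>)"
  shows "((\<lambda>z. g z - h z) has_path_integral (I - J)) (a, b, \<gamma>)"
  unfolding has_path_integral_def prod.case
proof (intro allI impI)
  fix e :: real assume "e > 0"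
  then have "e / 2 > 0" by simp
  obtain \<delta> where "\<delta> > 0" and \<delta>: "\<And>p. \<lbrakk>p tagged_division_of {a..b}; (\<lambda>t. ball t \<delta>) fine p\<rbrakk> \<Longrightarrow>
      norm ((\<Sum>(t, k)\<in>p. g (\<gamma> t) * (\<gamma> (Sup k) - \<gamma> (Inf k))) - I) < e / 2"
    using has_path_integralE[OF assms(1) \<open>e / 2 > 0\<close>] by blast
  obtain \<eta> where "\<eta> > 0" and \<eta>: "\<And>p. \<lbrakk>p tagged_division_of {a..b}; (\<lambda>t. ball t \<eta>) fine p\<rbrakk> \<Longrightarrow>
      norm ((\<Sum>(t, k)\<in>p. h (\<gamma> t) * (\<gamma> (Sup k) - \<gamma> (Inf k))) - J) < e / 2"
    using has_path_integralE[OF assms(2) \<open>e / 2 > 0\<close>] by blast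
  have "norm ((\<Sum>(t, k)\<in>p. (g (\<gamma> t) - h (\<gamma> t)) * (\<gamma> (Sup k) - \<gamma> (Inf k))) - (I - J)) < e"
    if p: "p tagged_division_of {a..b}" and fine: "(\<lambda>t. ball t (min \<delta> \<eta>)) fine p" for p
  proof -
    define S where "S q = (\<Sum>(t, k)\<in>p. q (\<gamma> t) * (\<gamma> (Sup k) - \<gamma> (Inf k)))" for q
    have "(\<lambda>t. ball t \<delta>) fine p" "(\<lambda>t. ball t \<eta>) fine p"
      using fine unfolding fine_def by (auto simp: subset_eq)
    then have "norm (S g - I) < e / 2" "norm (S h - J) < e / 2"
      using \<delta>[OF p] \<eta>[OF p] by (auto simp: S_def)
    moreover have "S (\<lambda>z. g z - h z) = S g - S h"
      unfolding S_def by (subst sum_subtractf[symmetric]) (simp add: case_prod_unfold left_diff_distrib)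
    then have "S (\<lambda>z. g z - h z) - (I - J) = (S g - I) - (S h - J)" by simp
    ultimately have "norm (S (\<lambda>z. g z - h z) - (I - J)) < e / 2 + e / 2"
      by (metis norm_triangle_ineq4 add_strict_mono order_le_less_trans)
    then show ?thesis by (simp add: S_def)
  qed
  then show "\<exists>\<delta>>0. \<forall>p. p tagged_division_of {a..b} \<and> (\<lambda>t. ball t \<delta>) fine p \<longrightarrow>
      norm ((\<Sum>(t, k)\<in>p. (g (\<gamma> t) - h (\<gamma> t)) * (\<gamma> (Sup k) - \<gamma> (Inf k))) - (I - J)) < e"
    using \<open>\<delta> > 0\<close> \<open>\<eta> > 0\<close> by (intro exI[of _ "min \<delta> \<eta>"]) auto
qed

text \<open>In a sum close to \<open>I\<close>, the constant part telescopes to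
  \<open>c * (\<gamma> b - \<gamma> a)\<close> and the rest is at most \<open>B\<close> times the
  increment of \<open>V\<close>. This is used where \<open>g\<close> is nearly constant along the
  path.\<close>

lemma has_path_integral_approx:
  assumes I: "(g has_path_integral I) (a, b, \<gamma>)" and "a \<le> b" and "B \<ge> 0"
    and near: "\<And>s. s \<in> {a..b} \<Longrightarrow> norm (g (\<gamma> s) - c) \<le> B"
    and V: "\<And>r s. \<lbrakk>a \<le> r; r \<le> s; s \<le> b\<rbrakk> \<Longrightarrow> norm (\<gamma> s - \<gamma> r) \<le> V s - V r"
  shows "norm (I - c * (\<gamma> b - \<gamma> a)) \<le> B * (V b - V a)"
proof (rule field_le_epsilon)
  fix e :: real assume "e > 0"
  then obtain \<delta> where "\<delta> > 0" and \<delta>: "\<And>p. \<lbrakk>p tagged_division_of {a..b}; (\<lambda>t. ball t \<delta>) fine p\<rbrakk> \<Longrightarrow>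
      norm ((\<Sum>(t, k)\<in>p. g (\<gamma> t) * (\<gamma> (Sup k) - \<gamma> (Inf k))) - I) < e"
    using has_path_integralE[OF I] by blast
  have "gauge (\<lambda>t::real. ball t \<delta>)"
    using \<open>\<delta> > 0\<close> by (simp add: gauge_def)
  then obtain p where p: "p tagged_division_of {a..b}" and fine: "(\<lambda>t. ball t \<delta>) fine p"
    by (rule fine_division_exists_real)
  define S where "S = (\<Sum>(t, k)\<in>p. g (\<gamma> t) * (\<gamma> (Sup k) - \<gamma> (Inf k)))"
  have "norm (\<Sum>(t, k)\<in>p. (g (\<gamma> t) - c) * (\<gamma> (Sup k) - \<gamma> (Inf k))) \<le> B * V b - B * V a"
  proof (rule norm_tagged_sum_le[OF p \<open>a \<le> b\<close>, where V = "\<lambda>s. B * V s" and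
        \<phi> = "\<lambda>t u v. (g (\<gamma> t) - c) * (\<gamma> v - \<gamma> u)"])
    fix t u v assume tuv: "(t, {u..v}) \<in> p" "a \<le> u" "u \<le> t" "t \<le> v" "v \<le> b"
    then have "norm (g (\<gamma> t) - c) * norm (\<gamma> v - \<gamma> u) \<le> B * (V v - V u)"
      using near[of t] V[of u v] \<open>B \<ge> 0\<close> by (intro mult_mono) auto
    then show "norm ((g (\<gamma> t) - c) * (\<gamma> v - \<gamma> u)) \<le> B * V v - B * V u"
      by (simp add: norm_mult right_diff_distrib[of B])
  qed
  moreover have "(\<Sum>(t, k)\<in>p. (g (\<gamma> t) - c) * (\<gamma> (Sup k) - \<gamma> (Inf k)))
      = S - c * (\<Sum>(t, k)\<in>p. \<gamma> (Sup k) - \<gamma> (Inf k))"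
    unfolding S_def sum_distrib_left
    by (subst sum_subtractf[symmetric]) (simp add: case_prod_unfold left_diff_distrib)
  ultimately have "norm (S - c * (\<gamma> b - \<gamma> a)) \<le> B * (V b - V a)"
    using additive_tagged_division_1[OF \<open>a \<le> b\<close> p, of \<gamma>] by (simp add: right_diff_distrib)
  moreover have "norm (S - I) < e"
    using \<delta>[OF p fine] by (simp add: S_def)
  moreover have "norm (I - c * (\<gamma> b - \<gamma> a)) \<le> norm (S - c * (\<gamma> b - \<gamma> a)) + norm (S - I)"
    using norm_triangle_ineq4[of "S - c * (\<gamma> b - \<gamma> a)" "S - I"] by simp
  ultimately show "norm (I - c * (\<gamma> b - \<gamma> a)) \<le> B * (V b - V a) + e" by linarith
qed

text \<open>The sums evaluate \<open>\<gamma>\<close> only at tags and endpoints inside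
  \<open>{a..b}\<close>. This frees arguments about subarcs from the extensional form of the members
  of \<open>F\<close>.\<close>

lemma has_path_integral_restrict:
  assumes "(g has_path_integral I) (a, b, restrict \<gamma> {a..b})"
  shows "(g has_path_integral I) (a, b, \<gamma>)"
proof -
  have "(\<Sum>(t, k)\<in>p. g (restrict \<gamma> {a..b} t) * (restrict \<gamma> {a..b} (Sup k) - restrict \<gamma> {a..b} (Inf k)))
      = (\<Sum>(t, k)\<in>p. g (\<gamma> t) * (\<gamma> (Sup k) - \<gamma> (Inf k)))" if p: "p tagged_division_of {a..b}" for p
  proof (rule sum.cong[OF refl])
    fix x assume x: "x \<in> p"
    obtain t k where tk: "x = (t, k)" by (cases x)
    obtain u v where k: "k = {u..v}"
      using tagged_division_ofD(4)[OF p] x tk by (metis box_real(2))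
    have "t \<in> {u..v}" "{u..v} \<subseteq> {a..b}"
      using tagged_division_ofD(2,3)[OF p, of t k] x tk k by auto
    then show "(case x of (t, k) \<Rightarrow> g (restrict \<gamma> {a..b} t) *
        (restrict \<gamma> {a..b} (Sup k) - restrict \<gamma> {a..b} (Inf k)))
        = (case x of (t, k) \<Rightarrow> g (\<gamma> t) * (\<gamma> (Sup k) - \<gamma> (Inf k)))"
      using tk k by auto
  qed
  then show ?thesis
    using assms by (simp add: has_path_integral_def cong: conj_cong)
qed

section \<open>Uniqueness of \<open>F\<close>-derivatives\<close>

text \<open>If \<open>w = g (\<gamma> t)\<close> is nonzero, then on a short subarc \<open>g\<close>
  stays within \<open>norm w / 2\<close> of \<open>w\<close>. A vanishing integral then forces the
  increments of \<open>\<gamma>\<close> below half of any bound on them; iterating makes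
  \<open>\<gamma>\<close> take equal values at two distinct parameters, against injectivity.\<close>

lemma path_integrals_zero_imp_zero:
  assumes "a < b" and cont: "continuous_on {a..b} \<gamma>" and inj: "inj_on \<gamma> {a..b}"
    and rect: "rectifiable (a, b, \<gamma>)"
    and g: "continuous_on (\<gamma> ` {a..b}) g"
    and zero: "\<And>c d. \<lbrakk>a \<le> c; c < d; d \<le> b\<rbrakk> \<Longrightarrow> (g has_path_integral 0) (c, d, \<gamma>)"
    and t: "t \<in> {a..b}"
  shows "g (\<gamma> t) = 0"
proof (rule ccontr)
  assume nz: "g (\<gamma> t) \<noteq> 0"
  define w where "w = g (\<gamma> t)"
  have "continuous_on {a..b} (g \<circ> \<gamma>)"
    using cont g by (rule continuous_on_compose)
  then obtain \<delta> where "\<delta> > 0" and \<delta>: "\<And>s. \<lbrakk>s \<in> {a..b}; dist s t < \<delta>\<rbrakk> \<Longrightarrow>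
      dist (g (\<gamma> s)) w < norm w / 2"
    using t nz unfolding continuous_on_iff o_def w_def by (metis half_gt_zero zero_less_norm_iff)
  \<comment> \<open>Half of \<open>\<delta>\<close> gives the strict inequality on the closed
    interval; \<open>max\<close> and \<open>min\<close> make it one-sided when \<open>t\<close> is
    an endpoint.\<close>
  define c where "c = max a (t - \<delta> / 2)"
  define d where "d = min b (t + \<delta> / 2)"
  have cd: "a \<le> c" "c < d" "d \<le> b"
    using \<open>a < b\<close> t \<open>\<delta> > 0\<close> by (auto simp: c_def d_def)
  have near: "norm (g (\<gamma> s) - w) \<le> norm w / 2" if "s \<in> {c..d}" for s
  proof -
    have "dist s t < \<delta>" "s \<in> {a..b}"
      using that \<open>\<delta> > 0\<close> by (auto simp: c_def d_def dist_real_def)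
    then show ?thesis using \<delta>[of s] by (simp add: dist_norm)
  qed
  obtain V where V: "\<And>r s. \<lbrakk>a \<le> r; r \<le> s; s \<le> b\<rbrakk> \<Longrightarrow> norm (\<gamma> s - \<gamma> r) \<le> V s - V r"
    using rectifiable_variation[OF rect] by blast
  \<comment> \<open>The bound must hold for all \<open>r\<close> and \<open>s\<close>: the next
    halving uses \<open>(1 / 2) ^ n * V\<close> as the bounding function on every subinterval of
    \<open>{r..s}\<close>.\<close>
  have halve: "norm (\<gamma> s - \<gamma> r) \<le> (1 / 2) ^ n * V s - (1 / 2) ^ n * V r"
    if "c \<le> r" "r \<le> s" "s \<le> d" for r s n
    using that
  proof (induction n arbitrary: r s)
    case 0
    then show ?case using V[of r s] cd by simp
  next
    case (Suc n)
    show ?case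
    proof (cases "r = s")
      case False
      \<comment> \<open>Here the integral is 0, the constant is \<open>w\<close> and the radius
        \<open>B\<close> is \<open>norm w / 2\<close>; cancelling \<open>norm w\<close> leaves the
        factor 1/2.\<close>
      have "norm (0 - w * (\<gamma> s - \<gamma> r)) \<le> norm w / 2 * ((1 / 2) ^ n * V s - (1 / 2) ^ n * V r)"
        by (rule has_path_integral_approx[where g = g]) (use Suc near zero[of r s] cd False in auto)
      then have "norm w * norm (\<gamma> s - \<gamma> r)
          \<le> norm w * (((1 / 2) ^ n * V s - (1 / 2) ^ n * V r) / 2)"
        by (simp add: norm_mult)
      then have "norm (\<gamma> s - \<gamma> r) \<le> ((1 / 2) ^ n * V s - (1 / 2) ^ n * V r) / 2"
        using nz by (subst (asm) mult_le_cancel_left_pos) (simp_all add: w_def)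
      then show ?thesis by (simp add: field_simps)
    qed simp
  qed
  have "(\<lambda>n. (1 / 2) ^ n * V d - (1 / 2) ^ n * V c) \<longlonglongrightarrow> 0 * V d - 0 * V c"
    by (intro tendsto_intros LIMSEQ_power_zero) auto
  then have "norm (\<gamma> d - \<gamma> c) \<le> 0 * V d - 0 * V c"
    by (rule LIMSEQ_le_const) (use halve[of c d] cd in auto)
  then have "\<gamma> d = \<gamma> c" by simp
  then show False
    using inj_onD[OF inj, of d c] cd by auto
qed

lemma usefulD:
  assumes "useful X F" and "(a, b, \<gamma>) \<in> F"
  shows "path_in X (a, b, \<gamma>)" and "inj_on \<gamma> {a..b}" and "rectifiable (a, b, \<gamma>)"
    and "\<lbrakk>a \<le> c; c < d; d \<le> b\<rbrakk> \<Longrightarrow> (c, d, restrict \<gamma> {c..d}) \<in> F"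
proof -
  have "jordan_arc_in X (a, b, \<gamma>) \<and> rectifiable (a, b, \<gamma>)"
    using assms unfolding useful_def by blast
  then show "path_in X (a, b, \<gamma>)" "inj_on \<gamma> {a..b}" "rectifiable (a, b, \<gamma>)"
    by (simp_all add: jordan_arc_in_def)
  show "(c, d, restrict \<gamma> {c..d}) \<in> F" if "a \<le> c" "c < d" "d \<le> b"
  proof -
    have "{c..d} \<subseteq> {a..b}" using that by simp
    then show ?thesis
      using assms \<open>c < d\<close> unfolding useful_def by blast
  qed
qed

text \<open>Since \<open>F\<close> contains all subarcs of its arcs, \<open>g - h\<close> has zero
  integral over each of them and so vanishes on \<open>images F\<close>. Continuity carries this to
  the closure, which lies in the closed set \<open>X\<close>.\<close>

lemma F_derivative_unique:
  assumes useful: "useful X F" and "closed X"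
    and g: "F_derivative X F f g" and h: "F_derivative X F f h"
    and z: "z \<in> closure (images F)"
  shows "g z = h z"
proof -
  note arc = usefulD[OF useful]
  have im: "images F \<subseteq> X"
    using arc(1) by (fastforce simp: images_def path_in_def)
  then have "closure (images F) \<subseteq> X"
    using \<open>closed X\<close> by (simp add: closure_minimal)
  moreover have diff: "continuous_on X (\<lambda>z. g z - h z)"
    using g h by (auto simp: F_derivative_def intro: continuous_on_diff)
  ultimately have cont: "continuous_on (closure (images F)) (\<lambda>z. g z - h z)"
    using continuous_on_subset by blast
  have "g y - h y = 0" if y: "y \<in> images F" for y
  proof -
    obtain a b \<gamma> t where F: "(a, b, \<gamma>) \<in> F" and t: "t \<in> {a..b}" "y = \<gamma> t"
      using y by (auto simp: images_def)
    have p: "a < b" "continuous_on {a..b} \<gamma>" "\<gamma> ` {a..b} \<subseteq> X"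
      using arc(1)[OF F] by (auto simp: path_in_def)
    have "((\<lambda>z. g z - h z) has_path_integral 0) (c, d, \<gamma>)" if cd: "a \<le> c" "c < d" "d \<le> b" for c d
    proof -
      have sub: "(c, d, restrict \<gamma> {c..d}) \<in> F"
        using arc(4)[OF F] cd by blast
      have "(g has_path_integral (f (\<gamma> d) - f (\<gamma> c))) (c, d, restrict \<gamma> {c..d})"
        using g sub cd by (fastforce simp: F_derivative_def)
      moreover have "(h has_path_integral (f (\<gamma> d) - f (\<gamma> c))) (c, d, restrict \<gamma> {c..d})"
        using h sub cd by (fastforce simp: F_derivative_def)
      ultimately have "((\<lambda>z. g z - h z) has_path_integral 0) (c, d, restrict \<gamma> {c..d})"
        using has_path_integral_diff by fastforce
      then show ?thesis by (rule has_path_integral_restrict)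
    qed
    then show ?thesis
      using path_integrals_zero_imp_zero[of a b \<gamma> "\<lambda>z. g z - h z" t] p t arc[OF F]
        continuous_on_subset[OF diff] by blast
  qed
  then show ?thesis
    using continuous_constant_on_closure[OF cont _ z, of 0] by simp
qed

section \<open>The inclusion and its isometry\<close>

text \<open>\<open>cderiv\<close> is a definite description, so uniqueness of the derivative is
  required; it holds because every point of a perfect set is a limit point.\<close>

lemma D1_has_field_derivative:
  assumes "perfect X" and "f \<in> D1 X" and "a \<in> X"
  shows "(f has_field_derivative cderiv X f a) (at a within X)"
proof -
  obtain D where D: "(f has_field_derivative D) (at a within X)"
    using assms by (auto simp: D1_def field_differentiable_def)
  have nontriv: "at a within X \<noteq> bot"
    using assms by (simp add: perfect_def isolated_in_islimpt_iff trivial_limit_within)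
  show ?thesis
    unfolding cderiv_def
    by (rule theI[where P = "\<lambda>D. (f has_field_derivative D) (at a within X)", OF D])
      (rule has_field_derivative_unique[OF _ D nontriv])
qed

lemma D1_F_derivative:
  assumes "perfect X" and "useful X F" and "f \<in> D1 X"
  shows "F_derivative X F f (cderiv X f)"
  unfolding F_derivative_def
proof (intro conjI ballI)
  show "continuous_on X f"
    using D1_has_field_derivative[OF assms(1,3)] by (rule DERIV_continuous_on)
  show cont: "continuous_on X (cderiv X f)"
    using assms by (simp add: D1_def)
  fix p assume "p \<in> F"
  moreover obtain a b \<gamma> where "p = (a, b, \<gamma>)" by (cases p)
  ultimately show "case p of (a, b, \<gamma>) \<Rightarrow> (cderiv X f has_path_integral (f (\<gamma> b) - f (\<gamma> a))) (a, b, \<gamma>)"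
    using has_path_integral_deriv[OF usefulD(1,3)[OF assms(2)] D1_has_field_derivative[OF assms(1,3)] cont]
    by simp
qed

theorem theorem4p17:
  fixes X :: "complex set" and F :: "cpath set"
  assumes "compact X" and "perfect X" and "useful X F"
  shows "D1 X \<subseteq> DF1 X F \<and>
         (\<forall>f\<in>D1 X. F_derivative X F f (cderiv X f)) \<and>
         (closure (images F) = X \<longrightarrow> (\<forall>f\<in>D1 X. DF1_norm X F f = D1_norm X f))"
proof (intro conjI ballI impI subsetI)
  fix f assume "f \<in> D1 X"
  then show F: "F_derivative X F f (cderiv X f)"
    using assms D1_F_derivative by blast
  then show "f \<in> DF1 X F"
    by (auto simp: DF1_def F_derivative_def)
  assume X: "closure (images F) = X"
  \<comment> \<open>The norm uses an arbitrary choice of derivative. \<open>cderiv X f\<close>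
    witnesses that one exists, and uniqueness identifies the two on
    \<open>closure (images F) = X\<close>.\<close>
  have "F_derivative X F f (SOME g. F_derivative X F f g)"
    using F by (rule someI[where P = "F_derivative X F f"])
  then have "(SOME g. F_derivative X F f g) z = cderiv X f z" if "z \<in> X" for z
    using F_derivative_unique[OF assms(3) compact_imp_closed[OF assms(1)] _ F] that X by blast
  then show "DF1_norm X F f = D1_norm X f"
    unfolding DF1_norm_def D1_norm_def sup_norm_def X by (simp cong: SUP_cong)
qed

end
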